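(* Let $\mathcal{H}$ be a graph and let $\mathbb{F}=\{\mathcal{F}_v : v\in V(\mathcal{H})\}$ be a family of graphs indexed by $V(\mathcal{H})$. Then the generalized lexicographic product $\mathcal{H}[\mathbb{F}]$ is a divisor graph if and only if $\mathcal{H}$ is a divisor graph and, for every $v\in V(\mathcal{H})$, $\mathcal{F}_v$ is also a divisor graph.
   Context: All graphs are simple and undirected (no loops, no multiple edges). $V(\Gamma)$ and $E(\Gamma)$ denote the vertex set and edge set of a graph $\Gamma$. A graph $\Gamma$ is a divisor graph if there is an injection $\alpha$ from $V(\Gamma)$ to the set of positive integers such that, for distinct $x,y\in V(\Gamma)$, $\{x,y\}\in E(\Gamma)$ if and only if $\alpha(x)\mid\alpha(y)$ or $\alpha(y)\mid\alpha(x)$. The generalized lexicographic product $\mathcal{H}[\mathbb{F}]$ is the undirected graph with vertex set $\{(v,w): v\in V(\mathcal{H}), w\in V(\mathcal{F}_v)\}$ in which $(v_1,w_1)$ and $(v_2,w_2)$ are adjacent if and only if $\{v_1,v_2\}\in E(\mathcal{H})$, or $v_1=v_2$ and $\{w_1,w_2\}\in E(\mathcal{F}_{v_1})$.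
   Formalization: Each graph F_v is assumed finite and nonempty (H may be infinite); the claim fails otherwise, e.g. for H = K_2 with both F_v infinite edgeless, or H = C_5 with all F_v empty. *)

theory Defs
  imports Main
begin

record 'a ugraph =
  verts :: "'a set"
  edges :: "'a set set"

definition simple_graph :: "'a ugraph \<Rightarrow> bool" where
  "simple_graph G \<longleftrightarrow> (\<forall>e\<in>edges G. e \<subseteq> verts G \<and> card e = 2)"

definition divisor_graph :: "'a ugraph \<Rightarrow> bool" where
  "divisor_graph G \<longleftrightarrow>
     (\<exists>\<alpha> :: 'a \<Rightarrow> nat.
        inj_on \<alpha> (verts G) \<and> (\<forall>x\<in>verts G. \<alpha> x > 0) \<and>
        (\<forall>x\<in>verts G. \<forall>y\<in>verts G. x \<noteq> y \<longrightarrow>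
           ({x, y} \<in> edges G \<longleftrightarrow> \<alpha> x dvd \<alpha> y \<or> \<alpha> y dvd \<alpha> x)))"

text \<open>
  A family of graphs indexed by the vertices of \<open>H\<close> is a function on vertices; only its values
  on \<open>verts H\<close> matter. All members live in one common vertex type, but their vertex sets
  may overlap or be unrelated.
\<close>

definition gen_lex_product :: "'a ugraph \<Rightarrow> ('a \<Rightarrow> 'b ugraph) \<Rightarrow> ('a \<times> 'b) ugraph" where
  "gen_lex_product H F =
     \<lparr> verts = {(v, w). v \<in> verts H \<and> w \<in> verts (F v)},
       edges = {{(v\<^sub>1, w\<^sub>1), (v\<^sub>2, w\<^sub>2)} | v\<^sub>1 w\<^sub>1 v\<^sub>2 w\<^sub>2.
                  v\<^sub>1 \<in> verts H \<and> w\<^sub>1 \<in> verts (F v\<^sub>1) \<and>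
                  v\<^sub>2 \<in> verts H \<and> w\<^sub>2 \<in> verts (F v\<^sub>2) \<and>
                  ({v\<^sub>1, v\<^sub>2} \<in> edges H \<or> v\<^sub>1 = v\<^sub>2 \<and> {w\<^sub>1, w\<^sub>2} \<in> edges (F v\<^sub>1))} \<rparr>"

lemma gen_lex_product_adjacent:
  assumes "v\<^sub>1 \<in> verts H" "w\<^sub>1 \<in> verts (F v\<^sub>1)" "v\<^sub>2 \<in> verts H" "w\<^sub>2 \<in> verts (F v\<^sub>2)"
  shows "{(v\<^sub>1, w\<^sub>1), (v\<^sub>2, w\<^sub>2)} \<in> edges (gen_lex_product H F) \<longleftrightarrow>
    {v\<^sub>1, v\<^sub>2} \<in> edges H \<or> v\<^sub>1 = v\<^sub>2 \<and> {w\<^sub>1, w\<^sub>2} \<in> edges (F v\<^sub>1)"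
  using assms by (auto simp: gen_lex_product_def doubleton_eq_iff insert_commute; blast)

lemma simple_graph_gen_lex_product:
  assumes "simple_graph H" "\<And>v. v \<in> verts H \<Longrightarrow> simple_graph (F v)"
  shows "simple_graph (gen_lex_product H F)"
proof -
  have "v\<^sub>1 \<noteq> v\<^sub>2" if "{v\<^sub>1, v\<^sub>2} \<in> edges H" for v\<^sub>1 v\<^sub>2
    using assms(1) that by (auto simp: simple_graph_def)
  moreover have "w\<^sub>1 \<noteq> w\<^sub>2" if "v \<in> verts H" "{w\<^sub>1, w\<^sub>2} \<in> edges (F v)" for v w\<^sub>1 w\<^sub>2
    using assms(2)[OF that(1)] that(2) by (auto simp: simple_graph_def)
  ultimately show ?thesis
    by (auto simp: simple_graph_def gen_lex_product_def card_insert_if; blast)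
qed

end

theory Submission
  imports Defs "HOL-Computational_Algebra.Primes" "HOL-Library.Infinite_Set"
    "HOL-Library.Nat_Bijection"
begin

text \<open>
  Divisor graphs are the comparability graphs of countable partial orders in which every element
  has only finitely many predecessors: divisibility is such an order on the positive integers, and
  conversely such an order is realised by giving each element its own prime and labelling \<open>x\<close> by
  the product of the primes of all elements below \<open>x\<close> (lemma
  \<open>divisor_graph_if_comparability_graph\<close>).

  If \<open>H\<close> and all \<open>F v\<close> are divisor graphs, the lexicographic sum of the corresponding orders has
  \<open>gen_lex_product H F\<close> as its comparability graph. An element over \<open>v\<close> lies above elements of
  finitely many fibres only, and finiteness of the fibres keeps its set of predecessors finite,
  even when \<open>H\<close> is infinite.

  The other direction holds because labellings restrict to induced subgraphs: each \<open>F v\<close> is the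
  fibre over \<open>v\<close>, and choosing one vertex in every (nonempty) fibre yields a copy of \<open>H\<close>.
\<close>

lemma divisor_graph_if_induced_subgraph:
  assumes "divisor_graph G"
    and "inj_on f (verts K)" and "f ` verts K \<subseteq> verts G"
    and "\<And>x y. \<lbrakk>x \<in> verts K; y \<in> verts K; x \<noteq> y\<rbrakk> \<Longrightarrow>
           {x, y} \<in> edges K \<longleftrightarrow> {f x, f y} \<in> edges G"
  shows "divisor_graph K"
proof -
  obtain \<alpha> :: "'a \<Rightarrow> nat" where \<alpha>: "inj_on \<alpha> (verts G)" "\<And>x. x \<in> verts G \<Longrightarrow> \<alpha> x > 0"
    "\<And>x y. \<lbrakk>x \<in> verts G; y \<in> verts G; x \<noteq> y\<rbrakk> \<Longrightarrow>
       {x, y} \<in> edges G \<longleftrightarrow> \<alpha> x dvd \<alpha> y \<or> \<alpha> y dvd \<alpha> x"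
    using assms(1) unfolding divisor_graph_def by blast
  have "inj_on (\<alpha> \<circ> f) (verts K)"
    using assms(2,3) \<alpha>(1) by (meson comp_inj_on inj_on_subset)
  moreover have "f x \<noteq> f y" if "x \<in> verts K" "y \<in> verts K" "x \<noteq> y" for x y
    using assms(2) that by (auto dest: inj_onD)
  ultimately show ?thesis
    unfolding divisor_graph_def using assms(3,4) \<alpha>(2,3)
    by (intro exI[of _ "\<alpha> \<circ> f"]) (auto simp: image_subset_iff)
qed

text \<open>
  The primes of the factors of \<open>\<Prod>y\<in>A. p y\<close> recover \<open>A\<close>, so divisibility of these squarefree
  products mirrors inclusion of finite sets.
\<close>

lemma prod_distinct_primes_dvd_iff_subset:
  fixes p :: "'a \<Rightarrow> nat"
  assumes "finite A" "finite B"
    and prime: "\<And>y. y \<in> A \<union> B \<Longrightarrow> prime (p y)"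
    and inj: "inj_on p (A \<union> B)"
  shows "(\<Prod>y\<in>A. p y) dvd (\<Prod>y\<in>B. p y) \<longleftrightarrow> A \<subseteq> B"
proof
  assume dvd: "(\<Prod>y\<in>A. p y) dvd (\<Prod>y\<in>B. p y)"
  show "A \<subseteq> B"
  proof
    fix x assume x: "x \<in> A"
    have "p x dvd (\<Prod>y\<in>B. p y)"
      using dvd_prodI[OF assms(1) x] dvd by (rule dvd_trans)
    then obtain y where y: "y \<in> B" "p x dvd p y"
      using prime x assms(2) by (auto simp: prime_dvd_prod_iff)
    then have "p x = p y"
      using prime x by (auto intro: primes_dvd_imp_eq)
    then show "x \<in> B"
      using inj x y(1) by (auto dest: inj_onD)
  qed
next
  assume "A \<subseteq> B"
  then show "(\<Prod>y\<in>A. p y) dvd (\<Prod>y\<in>B. p y)"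
    using assms(2) by (intro prod_dvd_prod_subset) auto
qed

text \<open>
  The map \<open>c\<close> witnesses countability; composed with an enumeration of the primes it supplies the
  distinct primes for the vertices. With the label of \<open>x\<close> being the product over the down-set
  of \<open>x\<close>, divisibility of labels is inclusion of down-sets, which is the given order.
\<close>

lemma divisor_graph_if_comparability_graph:
  fixes c :: "'a \<Rightarrow> nat" and le :: "'a \<Rightarrow> 'a \<Rightarrow> bool"
  assumes c: "inj_on c (verts G)"
    and refl: "\<And>x. x \<in> verts G \<Longrightarrow> le x x"
    and antisym: "\<And>x y. \<lbrakk>x \<in> verts G; y \<in> verts G; le x y; le y x\<rbrakk> \<Longrightarrow> x = y"
    and trans: "\<And>x y z. \<lbrakk>x \<in> verts G; y \<in> verts G; z \<in> verts G; le x y; le y z\<rbrakk> \<Longrightarrow> le x z"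
    and fin: "\<And>x. x \<in> verts G \<Longrightarrow> finite {y \<in> verts G. le y x}"
    and edge: "\<And>x y. \<lbrakk>x \<in> verts G; y \<in> verts G; x \<noteq> y\<rbrakk> \<Longrightarrow>
                 {x, y} \<in> edges G \<longleftrightarrow> le x y \<or> le y x"
  shows "divisor_graph G"
proof -
  define p where "p = enumerate {q::nat. prime q} \<circ> c"
  define D where "D x = {y \<in> verts G. le y x}" for x
  define \<gamma> where "\<gamma> x = (\<Prod>y\<in>D x. p y)" for x
  have prime: "prime (p y)" for y
    using enumerate_in_set[OF primes_infinite] by (simp add: p_def)
  have inj: "inj_on p (verts G)"
    unfolding p_def
    using c strict_mono_imp_inj_on[OF strict_mono_enumerate[OF primes_infinite]]
    by (auto intro: comp_inj_on inj_on_subset)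
  have dvd_iff: "\<gamma> x dvd \<gamma> y \<longleftrightarrow> le x y" if "x \<in> verts G" "y \<in> verts G" for x y
  proof -
    have "\<gamma> x dvd \<gamma> y \<longleftrightarrow> D x \<subseteq> D y"
      unfolding \<gamma>_def using fin that prime inj
      by (intro prod_distinct_primes_dvd_iff_subset) (auto simp: D_def intro: inj_on_subset)
    also have "\<dots> \<longleftrightarrow> le x y"
      unfolding D_def using that refl trans by blast
    finally show ?thesis .
  qed
  have "inj_on \<gamma> (verts G)"
    using dvd_iff antisym by (metis dvd_refl inj_onI)
  moreover have "\<gamma> x > 0" for x
    unfolding \<gamma>_def by (intro prod_pos) (simp add: prime prime_gt_0_nat)
  ultimately show ?thesis
    unfolding divisor_graph_def using dvd_iff edge by (intro exI[of _ \<gamma>]) auto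
qed

text \<open>
  The order used is the lexicographic one: elements of different fibres are compared in \<open>H\<close>,
  elements of one fibre in that fibre.
\<close>

lemma divisor_graph_gen_lex_product:
  fixes H :: "'a ugraph" and F :: "'a \<Rightarrow> 'b ugraph"
  assumes "simple_graph H"
    and finF: "\<And>v. v \<in> verts H \<Longrightarrow> finite (verts (F v))"
    and "divisor_graph H"
    and "\<And>v. v \<in> verts H \<Longrightarrow> divisor_graph (F v)"
  shows "divisor_graph (gen_lex_product H F)"
proof -
  obtain \<alpha> :: "'a \<Rightarrow> nat" where \<alpha>: "inj_on \<alpha> (verts H)" "\<And>x. x \<in> verts H \<Longrightarrow> \<alpha> x > 0"
    "\<And>x y. \<lbrakk>x \<in> verts H; y \<in> verts H; x \<noteq> y\<rbrakk> \<Longrightarrow>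
       {x, y} \<in> edges H \<longleftrightarrow> \<alpha> x dvd \<alpha> y \<or> \<alpha> y dvd \<alpha> x"
    using assms(3) unfolding divisor_graph_def by blast
  obtain \<beta> :: "'a \<Rightarrow> 'b \<Rightarrow> nat" where \<beta>: "\<And>v. v \<in> verts H \<Longrightarrow> inj_on (\<beta> v) (verts (F v))"
    "\<And>v x y. \<lbrakk>v \<in> verts H; x \<in> verts (F v); y \<in> verts (F v); x \<noteq> y\<rbrakk> \<Longrightarrow>
       {x, y} \<in> edges (F v) \<longleftrightarrow> \<beta> v x dvd \<beta> v y \<or> \<beta> v y dvd \<beta> v x"
    using assms(4) unfolding divisor_graph_def by metis
  have \<alpha>_eq: "v = v'" if "v \<in> verts H" "v' \<in> verts H" "\<alpha> v dvd \<alpha> v'" "\<alpha> v' dvd \<alpha> v" for v v'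
    using that \<alpha>(1) by (auto intro: inj_onD dvd_antisym)
  have \<beta>_eq: "w = w'"
    if "v \<in> verts H" "w \<in> verts (F v)" "w' \<in> verts (F v)" "\<beta> v w dvd \<beta> v w'" "\<beta> v w' dvd \<beta> v w"
    for v w w'
    using that \<beta>(1) by (auto intro: inj_onD dvd_antisym)
  let ?G = "gen_lex_product H F"
  have vG: "verts ?G = (SIGMA v:verts H. verts (F v))"
    by (auto simp: gen_lex_product_def)
  define le where "le x y \<longleftrightarrow> \<alpha> (fst x) dvd \<alpha> (fst y) \<and>
      (fst x = fst y \<longrightarrow> \<beta> (fst x) (snd x) dvd \<beta> (fst x) (snd y))" for x y :: "'a \<times> 'b"
  show ?thesis
  proof (rule divisor_graph_if_comparability_graph
      [where c = "\<lambda>(v, w). prod_encode (\<alpha> v, \<beta> v w)" and le = le])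
    show "inj_on (\<lambda>(v, w). prod_encode (\<alpha> v, \<beta> v w)) (verts ?G)"
      unfolding vG using \<alpha>(1) \<beta>(1) by (fastforce intro!: inj_onI dest: inj_onD)
  next
    fix x assume "x \<in> verts ?G"
    show "le x x" by (simp add: le_def)
  next
    fix x y assume "x \<in> verts ?G" "y \<in> verts ?G" "le x y" "le y x"
    then show "x = y"
      unfolding vG le_def using \<alpha>_eq[of "fst x" "fst y"] \<beta>_eq[of "fst x" "snd x" "snd y"]
      by (auto simp: prod_eq_iff)
  next
    fix x y z assume "x \<in> verts ?G" "y \<in> verts ?G" "z \<in> verts ?G" "le x y" "le y z"
    \<comment> \<open>If \<open>x\<close> and \<open>z\<close> lie in one fibre, antisymmetry in \<open>H\<close> puts \<open>y\<close> there as well.\<close>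
    then show "le x z"
      unfolding vG le_def using \<alpha>_eq[of "fst x" "fst y"] by (auto intro: dvd_trans)
  next
    fix x assume x: "x \<in> verts ?G"
    let ?D = "{v \<in> verts H. \<alpha> v dvd \<alpha> (fst x)}"
    have "finite (\<alpha> ` ?D)"
      using x \<alpha>(2) unfolding vG by (intro finite_subset[OF _ finite_divisors_nat[of "\<alpha> (fst x)"]]) auto
    then have "finite ?D"
      by (rule finite_imageD) (auto intro: inj_on_subset[OF \<alpha>(1)])
    then have "finite (SIGMA v:?D. verts (F v))"
      using finF by (intro finite_SigmaI) auto
    then show "finite {y \<in> verts ?G. le y x}"
      by (rule rev_finite_subset) (auto simp: vG le_def)
  next
    fix x y assume xy: "x \<in> verts ?G" "y \<in> verts ?G" "x \<noteq> y"
    obtain v w v' w' where [simp]: "x = (v, w)" "y = (v', w')" by fastforce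
    have mem: "v \<in> verts H" "w \<in> verts (F v)" "v' \<in> verts H" "w' \<in> verts (F v')"
      using xy by (auto simp: vG)
    have no_loop: "{v} \<notin> edges H"
      using assms(1) by (auto simp: simple_graph_def)
    show "{x, y} \<in> edges ?G \<longleftrightarrow> le x y \<or> le y x"
    proof (cases "v = v'")
      case True
      then show ?thesis
        using mem xy(3) \<beta>(2)[of v w w'] no_loop by (auto simp: gen_lex_product_adjacent le_def)
    next
      case False
      then show ?thesis
        using mem \<alpha>(3)[of v v'] by (auto simp: gen_lex_product_adjacent le_def)
    qed
  qed
qed

theorem theorem3p1:
  fixes H :: "'a ugraph" and F :: "'a \<Rightarrow> 'b ugraph"
  assumes "simple_graph H"
    and "\<And>v. v \<in> verts H \<Longrightarrow> simple_graph (F v)"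
    and "\<And>v. v \<in> verts H \<Longrightarrow> finite (verts (F v))"
    and "\<And>v. v \<in> verts H \<Longrightarrow> verts (F v) \<noteq> {}"
  shows "divisor_graph (gen_lex_product H F) \<longleftrightarrow>
           divisor_graph H \<and> (\<forall>v\<in>verts H. divisor_graph (F v))"
proof (intro iffI conjI ballI)
  assume G: "divisor_graph (gen_lex_product H F)"
  have "\<forall>v\<in>verts H. \<exists>w. w \<in> verts (F v)"
    using assms(4) by blast
  then obtain s where s: "\<And>v. v \<in> verts H \<Longrightarrow> s v \<in> verts (F v)"
    by (auto dest!: bchoice)
  show "divisor_graph H"
    using G
  proof (rule divisor_graph_if_induced_subgraph[where f = "\<lambda>v. (v, s v)"])
    show "inj_on (\<lambda>v. (v, s v)) (verts H)"
      by (auto intro: inj_onI)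
    show "(\<lambda>v. (v, s v)) ` verts H \<subseteq> verts (gen_lex_product H F)"
      using s by (auto simp: gen_lex_product_def)
  qed (simp add: gen_lex_product_adjacent s)
  fix v assume v: "v \<in> verts H"
  have no_loop: "{v} \<notin> edges H"
    using assms(1) by (auto simp: simple_graph_def)
  show "divisor_graph (F v)"
    using G
  proof (rule divisor_graph_if_induced_subgraph[where f = "Pair v"])
    show "Pair v ` verts (F v) \<subseteq> verts (gen_lex_product H F)"
      using v by (auto simp: gen_lex_product_def)
  qed (simp_all add: gen_lex_product_adjacent v no_loop inj_on_def)
next
  assume "divisor_graph H \<and> (\<forall>v\<in>verts H. divisor_graph (F v))"
  then show "divisor_graph (gen_lex_product H F)"
    using assms(1,3) by (intro divisor_graph_gen_lex_product) auto
qed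

end
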